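(* Let $1\le p<\infty$ and $0<\delta<1$ with $p\delta\ge 1$. Then there exists a John domain $G\subset\mathbb{R}^n$ (for some $n\ge 2$) for which the following fails: there exists a constant $C>0$ such that, for every $u\in L^1(G)$, $$\int_G\int_G\frac{|u(x)-u(y)|^p}{|x-y|^{n+\delta p}}\,dy\,dx\le C\int_G\int_{B(x,\mathrm{dist}(x,\partial G))}\frac{|u(x)-u(y)|^p}{|x-y|^{n+\delta p}}\,dy\,dx .$$
   Context: $\mathrm{dist}(x,\partial G)$ is the distance from $x\in G$ to the boundary of $G$, and $B(x,r)$ is the ball of center $x$ and radius $r$. Both sides of the inequality take values in $[0,\infty]$. A bounded domain (open connected set) $G$ in $\mathbb{R}^n$, $n\ge 2$, is a $c$-John domain with constant $c\ge 1$ if there exists $x_0\in G$ such that every point $x\in G$ can be joined to $x_0$ by a rectifiable curve $\gamma:[0,\ell]\to G$, parametrized by its arc length, with $\gamma(0)=x$, $\gamma(\ell)=x_0$ and $\mathrm{dist}(\gamma(t),\partial G)\ge t/c$ for every $t\in[0,\ell]$. A John domain is a $c$-John domain for some $c\ge 1$. *)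

theory Defs
  imports "HOL-Analysis.Analysis"
begin

text \<open>
  The dimension \<open>n\<close> is existentially quantified in the theorem, so it cannot be a type parameter.
  Accordingly \<open>\<real>\<^sup>n\<close> is the set of functions on \<open>{..<n}\<close> (extended by \<open>undefined\<close>), which is also
  the space of the library's finite product measure over \<open>{..<n}\<close>.
\<close>

definition Rn :: "nat \<Rightarrow> (nat \<Rightarrow> real) set" where
  "Rn n = PiE {..<n} (\<lambda>_. UNIV)"

definition Rdist :: "nat \<Rightarrow> (nat \<Rightarrow> real) \<Rightarrow> (nat \<Rightarrow> real) \<Rightarrow> real" where
  "Rdist n x y = L2_set (\<lambda>i. x i - y i) {..<n}"

interpretation Rn: Metric_space "Rn n" "Rdist n" for n :: nat
proof
  show "0 \<le> Rdist n x y" for x y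
    by (simp add: Rdist_def)
  show "Rdist n x y = Rdist n y x" for x y
    by (simp add: Rdist_def L2_set_def power2_commute)
  show "Rdist n x y = 0 \<longleftrightarrow> x = y" if "x \<in> Rn n" "y \<in> Rn n" for x y
    using that PiE_ext[of x "{..<n}" "\<lambda>_. UNIV" y]
    by (auto simp: Rdist_def Rn_def L2_set_eq_0_iff)
  show "Rdist n x z \<le> Rdist n x y + Rdist n y z" for x y z
    using L2_set_triangle_ineq[of "\<lambda>i. x i - y i" "\<lambda>i. y i - z i" "{..<n}"]
    by (simp add: Rdist_def)
qed

definition Rn_lebesgue :: "nat \<Rightarrow> (nat \<Rightarrow> real) measure" where
  "Rn_lebesgue n = completion (PiM {..<n} (\<lambda>_. lborel))"

definition boundary_dist :: "nat \<Rightarrow> (nat \<Rightarrow> real) set \<Rightarrow> (nat \<Rightarrow> real) \<Rightarrow> real" where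
  "boundary_dist n G x = (INF y \<in> Rn.mtopology n frontier_of G. Rdist n x y)"

text \<open>The length of \<open>g\<close> on \<open>[a, b]\<close>, as the supremum of the lengths of inscribed polygons.\<close>

definition curve_length :: "nat \<Rightarrow> (real \<Rightarrow> nat \<Rightarrow> real) \<Rightarrow> real \<Rightarrow> real \<Rightarrow> ennreal" where
  "curve_length n g a b =
     (SUP (m, s) \<in> {(m :: nat, s :: nat \<Rightarrow> real). mono_on {..m} s \<and> s 0 = a \<and> s m = b}.
        \<Sum>i<m. ennreal (Rdist n (g (s i)) (g (s (Suc i)))))"

text \<open>
  A curve \<open>g\<close> on \<open>[0, l]\<close> is parametrized by arc length if its restriction to \<open>[0, t]\<close> has length \<open>t\<close>
  for every \<open>t\<close>; in particular it is then rectifiable, of total length \<open>l\<close>.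
\<close>

definition arclength_curve_in ::
  "nat \<Rightarrow> (nat \<Rightarrow> real) set \<Rightarrow> real \<Rightarrow> (real \<Rightarrow> nat \<Rightarrow> real) \<Rightarrow> bool" where
  "arclength_curve_in n G l g \<longleftrightarrow>
     0 \<le> l \<and>
     continuous_map (top_of_set {0..l}) (subtopology (Rn.mtopology n) G) g \<and>
     (\<forall>t\<in>{0..l}. curve_length n g 0 t = ennreal t)"

definition c_John_domain :: "nat \<Rightarrow> real \<Rightarrow> (nat \<Rightarrow> real) set \<Rightarrow> bool" where
  "c_John_domain n c G \<longleftrightarrow>
     openin (Rn.mtopology n) G \<and> connectedin (Rn.mtopology n) G \<and> Rn.mbounded n G \<and> 1 \<le> c \<and>
     (\<exists>x0\<in>G. \<forall>x\<in>G. \<exists>l g. arclength_curve_in n G l g \<and> g 0 = x \<and> g l = x0 \<and>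
        (\<forall>t\<in>{0..l}. t / c \<le> boundary_dist n G (g t)))"

definition John_domain :: "nat \<Rightarrow> (nat \<Rightarrow> real) set \<Rightarrow> bool" where
  "John_domain n G \<longleftrightarrow> (\<exists>c. c_John_domain n c G)"

text \<open>The value \<open>0\<close> on the diagonal (from division by zero) is immaterial: slices of the diagonal are null.\<close>

definition frac_kernel ::
  "nat \<Rightarrow> real \<Rightarrow> real \<Rightarrow> ((nat \<Rightarrow> real) \<Rightarrow> real) \<Rightarrow> (nat \<Rightarrow> real) \<Rightarrow> (nat \<Rightarrow> real) \<Rightarrow> ennreal" where
  "frac_kernel n \<delta> p u x y =
     ennreal (\<bar>u x - u y\<bar> powr p / Rdist n x y powr (real n + \<delta> * p))"

end

theory Submission
  imports Defs
begin

text \<open>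
  The counterexample is a slit domain in the plane, with a function that jumps across the slit. Points
  \<open>x\<close> and \<open>y\<close> on opposite sides of the slit interact in the integral over \<open>G \<times> G\<close>, but never in the
  integral over the balls \<open>B(x, dist(x, \<partial>G))\<close>, which do not reach beyond the slit.

  Take \<open>G\<close> to be the square \<open>(-1, 1)\<^sup>2\<close> without \<open>[0, 1) \<times> {0}\<close>, and let \<open>u\<close> be the positive part of the first
  coordinate in the upper half of the square and \<open>0\<close> in the lower half. On each ball \<open>B(x, dist(x, \<partial>G))\<close>
  one has \<open>\<bar>u x - u y\<bar> \<le> \<bar>x - y\<bar>\<close> (\<open>jump_Lipschitz_on_boundary_ball\<close>), so the integrand there is at most
  \<open>\<bar>x - y\<bar>\<close> to the power \<open>p * (1 - \<delta>) - 2\<close>. This exponent exceeds \<open>-2\<close>, and the right-hand side is finite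
  (\<open>boundary_ball_energy_finite\<close>). On the other hand, a point at height \<open>h\<close> above the right half of the slit
  sees a square of area \<open>h\<^sup>2\<close> below the slit, at a distance of order \<open>h\<close>, across a jump of height at least
  \<open>1 / 2\<close>. This contributes at least the order of \<open>h\<close> to the power \<open>2 - (2 + \<delta> * p)\<close>, and since \<open>\<delta> * p \<ge> 1\<close>
  the integral over \<open>h\<close> diverges (\<open>jump_energy_infinite\<close>). So no constant \<open>C\<close> can work.

  The slit square is a John domain because its halves above and below the slit are convex: from a point of the
  upper (lower) half, walk straight to \<open>(0, 1 / 2)\<close> (to \<open>(0, -1 / 2)\<close>), the centre of that half, and from
  there straight past the tip of the slit to \<open>(-1 / 2, 0)\<close> (\<open>slit_square_two_leg_path\<close>).
\<close>

section \<open>Polygonal paths parametrized by arc length\<close>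

lemma Rdist_nonneg: "0 \<le> Rdist n x y"
  by (simp add: Rdist_def)

lemma Rdist_2: "Rdist 2 x y = sqrt ((x 0 - y 0)\<^sup>2 + (x 1 - y 1)\<^sup>2)"
  by (simp add: Rdist_def L2_set_def numeral_2_eq_2)

lemma abs_coord_le_Rdist: "i < n \<Longrightarrow> \<bar>x i - y i\<bar> \<le> Rdist n x y"
  using member_le_L2_set[of "{..<n}" i "\<lambda>i. \<bar>x i - y i\<bar>"]
  by (simp add: Rdist_def L2_set_def)

text \<open>
  A path made of two isometric pieces is 1-Lipschitz, so no inscribed polygon on \<open>[0, t]\<close> is longer
  than \<open>t\<close>; the polygon with the single inner vertex \<open>g b\<close>, where the pieces meet, attains that length.
\<close>

lemma arclength_curve_of_isometric_pieces:
  assumes b: "0 \<le> b" "b \<le> l" and G: "G \<subseteq> Rn n" "\<And>t. t \<in> {0..l} \<Longrightarrow> g t \<in> G"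
    and iso1: "\<And>s t. s \<in> {0..b} \<Longrightarrow> t \<in> {0..b} \<Longrightarrow> Rdist n (g s) (g t) = \<bar>s - t\<bar>"
    and iso2: "\<And>s t. s \<in> {b..l} \<Longrightarrow> t \<in> {b..l} \<Longrightarrow> Rdist n (g s) (g t) = \<bar>s - t\<bar>"
  shows "arclength_curve_in n G l g"
proof -
  have lip: "Rdist n (g s) (g t) \<le> t - s" if "0 \<le> s" "s \<le> t" "t \<le> l" for s t
  proof -
    consider "t \<le> b" | "b \<le> s" | "s \<le> b" "b \<le> t" by linarith
    then show ?thesis
    proof cases
      case 3
      have "Rdist n (g s) (g t) \<le> Rdist n (g s) (g b) + Rdist n (g b) (g t)"
        using G b that by (intro Rn.triangle) (auto simp: subset_iff)
      also have "\<dots> = t - s"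
        using iso1[of s b] iso2[of b t] 3 that b by simp
      finally show ?thesis .
    qed (use iso1[of s t] iso2[of s t] that in auto)
  qed
  have lip': "Rdist n (g s) (g t) \<le> \<bar>t - s\<bar>" if "s \<in> {0..l}" "t \<in> {0..l}" for s t
    using lip[of s t] lip[of t s] that Rn.commute[of n "g s" "g t"] by (cases "s \<le> t") auto
  have cont: "continuous_map (top_of_set {0..l}) (subtopology (Rn.mtopology n) G) g"
  proof (rule continuous_map_into_subtopology)
    show "continuous_map (top_of_set {0..l}) (Rn.mtopology n) g"
      unfolding Rn.continuous_map_to_metric
    proof (intro ballI allI impI)
      fix t and e :: real assume t: "t \<in> topspace (top_of_set {0..l})" and e: "0 < e"
      have "g s \<in> Rn.mball n (g t) e" if "s \<in> {0..l} \<inter> ball t e" for s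
        using lip'[of t s] that t G by (auto simp: dist_real_def subset_iff)
      then show "\<exists>U. openin (top_of_set {0..l}) U \<and> t \<in> U \<and> (\<forall>s\<in>U. g s \<in> Rn.mball n (g t) e)"
        using t e by (intro exI[of _ "{0..l} \<inter> ball t e"]) auto
    qed
  qed (use G in auto)
  have "curve_length n g 0 t = ennreal t" if t: "t \<in> {0..l}" for t
  proof (rule antisym)
    show "curve_length n g 0 t \<le> ennreal t"
      unfolding curve_length_def
    proof (rule SUP_least)
      fix ms :: "nat \<times> (nat \<Rightarrow> real)"
      assume "ms \<in> {(m, s). mono_on {..m} s \<and> s 0 = 0 \<and> s m = t}"
      then obtain m s where ms: "ms = (m, s)" and m: "mono_on {..m} s" and s: "0 = s 0" "t = s m"
        by auto
      have s_le: "s i \<le> s j" if "i \<le> j" "j \<le> m" for i j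
        using m that by (auto simp: mono_on_def)
      have "(\<Sum>i<m. ennreal (Rdist n (g (s i)) (g (s (Suc i))))) \<le> (\<Sum>i<m. ennreal (s (Suc i) - s i))"
      proof (intro sum_mono ennreal_leI lip)
        fix i assume "i \<in> {..<m}"
        then show "0 \<le> s i" "s i \<le> s (Suc i)" "s (Suc i) \<le> l"
          using s_le[of 0 i] s_le[of i "Suc i"] s_le[of "Suc i" m] s t by auto
      qed
      also have "\<dots> = ennreal (\<Sum>i<m. s (Suc i) - s i)"
        using s_le by (intro sum_ennreal) auto
      also have "\<dots> = ennreal (s m)"
        by (simp add: sum_lessThan_telescope flip: s(1))
      finally show "(case ms of (m, s) \<Rightarrow> \<Sum>i<m. ennreal (Rdist n (g (s i)) (g (s (Suc i))))) \<le> ennreal t"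
        by (simp add: ms s(2))
    qed
    \<comment> \<open>For \<open>t < b\<close> the second side of this polygon degenerates to a point.\<close>
    define s :: "nat \<Rightarrow> real" where "s = (\<lambda>i. if i = 0 then 0 else if i = 1 then min b t else t)"
    have "ennreal t = ennreal (Rdist n (g (s 0)) (g (s 1))) + ennreal (Rdist n (g (s 1)) (g (s 2)))"
      using iso1[of 0 "min b t"] iso1[of t t] iso2[of b t] t b
      by (cases "t \<le> b") (auto simp: s_def min_def simp flip: ennreal_plus)
    also have "\<dots> = (\<Sum>i<2. ennreal (Rdist n (g (s i)) (g (s (Suc i)))))"
      by (simp add: numeral_2_eq_2)
    also have "\<dots> \<le> curve_length n g 0 t"
      unfolding curve_length_def
      by (rule SUP_upper2[of "(2, s)"]) (use b t in \<open>auto simp: s_def mono_on_def\<close>)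
    finally show "ennreal t \<le> curve_length n g 0 t" .
  qed
  then show ?thesis
    using b cont by (auto simp: arclength_curve_in_def)
qed

definition segment_point :: "nat \<Rightarrow> (nat \<Rightarrow> real) \<Rightarrow> (nat \<Rightarrow> real) \<Rightarrow> real \<Rightarrow> nat \<Rightarrow> real" where
  "segment_point n x y r = (\<lambda>i\<in>{..<n}. x i + r * (y i - x i))"

lemma segment_point_in_Rn: "segment_point n x y r \<in> Rn n"
  by (auto simp: segment_point_def Rn_def)

lemma segment_point_ends:
  assumes "x \<in> Rn n" "y \<in> Rn n"
  shows "segment_point n x y 0 = x" "segment_point n x y 1 = y"
  using assms by (auto simp: segment_point_def Rn_def intro!: PiE_ext)

lemma Rdist_segment_point:
  "Rdist n (segment_point n x y r) (segment_point n x y s) = \<bar>r - s\<bar> * Rdist n x y"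
proof -
  have "Rdist n (segment_point n x y r) (segment_point n x y s)
      = L2_set (\<lambda>i. \<bar>r - s\<bar> * (x i - y i)) {..<n}"
    unfolding Rdist_def L2_set_def
  proof (intro arg_cong[where f = sqrt] sum.cong refl)
    fix i assume "i \<in> {..<n}"
    then have "segment_point n x y r i - segment_point n x y s i = (r - s) * (y i - x i)"
      by (simp add: segment_point_def algebra_simps)
    then show "(segment_point n x y r i - segment_point n x y s i)\<^sup>2 = (\<bar>r - s\<bar> * (x i - y i))\<^sup>2"
      by (simp add: power_mult_distrib power2_commute[of "x i"])
  qed
  also have "\<dots> = \<bar>r - s\<bar> * Rdist n x y"
    by (simp add: Rdist_def L2_set_right_distrib)
  finally show ?thesis .
qed

text \<open>
  The parameter is the distance travelled. A leg of length \<open>0\<close> causes no trouble: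
  the division by \<open>0\<close> then yields the starting point of that leg, which is also its end point.
\<close>

definition two_leg_path ::
  "nat \<Rightarrow> (nat \<Rightarrow> real) \<Rightarrow> (nat \<Rightarrow> real) \<Rightarrow> (nat \<Rightarrow> real) \<Rightarrow> real \<Rightarrow> nat \<Rightarrow> real" where
  "two_leg_path n x q z t =
     (if t \<le> Rdist n x q then segment_point n x q (t / Rdist n x q)
      else segment_point n q z ((t - Rdist n x q) / Rdist n q z))"

lemma two_leg_path_second_leg:
  assumes "x \<in> Rn n" "q \<in> Rn n" "z \<in> Rn n" "Rdist n x q \<le> t"
  shows "two_leg_path n x q z t = segment_point n q z ((t - Rdist n x q) / Rdist n q z)"
  using assms Rn.zero[of x n q] by (auto simp: two_leg_path_def segment_point_ends)

lemma two_leg_path_end: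
  assumes "x \<in> Rn n" "q \<in> Rn n" "z \<in> Rn n"
  shows "two_leg_path n x q z (Rdist n x q + Rdist n q z) = z"
  using assms two_leg_path_second_leg[OF assms] Rn.zero[of q n z] Rdist_nonneg[of n q z]
  by (cases "q = z") (auto simp: segment_point_ends)

lemma arclength_curve_two_leg_path:
  assumes Rn: "x \<in> Rn n" "q \<in> Rn n" "z \<in> Rn n" and G: "G \<subseteq> Rn n"
    "\<And>t. t \<in> {0..Rdist n x q + Rdist n q z} \<Longrightarrow> two_leg_path n x q z t \<in> G"
  shows "arclength_curve_in n G (Rdist n x q + Rdist n q z) (two_leg_path n x q z)"
proof (rule arclength_curve_of_isometric_pieces[where b = "Rdist n x q"])
  fix s t assume st: "s \<in> {0..Rdist n x q}" "t \<in> {0..Rdist n x q}"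
  then show "Rdist n (two_leg_path n x q z s) (two_leg_path n x q z t) = \<bar>s - t\<bar>"
    by (cases "Rdist n x q = 0")
      (auto simp: two_leg_path_def Rdist_segment_point Rdist_nonneg abs_divide
        simp flip: diff_divide_distrib)
next
  fix s t assume st: "s \<in> {Rdist n x q..Rdist n x q + Rdist n q z}"
    "t \<in> {Rdist n x q..Rdist n x q + Rdist n q z}"
  then show "Rdist n (two_leg_path n x q z s) (two_leg_path n x q z t) = \<bar>s - t\<bar>"
    by (cases "Rdist n q z = 0")
      (auto simp: two_leg_path_second_leg[OF Rn] Rdist_segment_point Rdist_nonneg abs_divide
        simp flip: diff_divide_distrib)
qed (use G in \<open>auto simp: Rdist_nonneg\<close>)

section \<open>Distance to the boundary\<close>

lemma boundary_dist_le:
  "y \<in> Rn.mtopology n frontier_of G \<Longrightarrow> boundary_dist n G x \<le> Rdist n x y"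
  unfolding boundary_dist_def
  by (rule cINF_lower[OF bdd_belowI2[where m = 0]]) (simp_all add: Rdist_nonneg)

lemma boundary_dist_ge:
  assumes "openin (Rn.mtopology n) G" "Rn.mtopology n frontier_of G \<noteq> {}"
    and "\<And>w. w \<in> Rn n \<Longrightarrow> w \<notin> G \<Longrightarrow> r \<le> Rdist n x w"
  shows "r \<le> boundary_dist n G x"
  unfolding boundary_dist_def
proof (rule cINF_greatest)
  fix w assume "w \<in> Rn.mtopology n frontier_of G"
  then have "w \<in> Rn n" "w \<notin> G"
    using assms(1) frontier_of_subset_topspace[of "Rn.mtopology n" G]
    by (simp_all add: frontier_of_def interior_of_openin subset_iff)
  then show "r \<le> Rdist n x w" by (rule assms(3))
qed (fact assms(2))

section \<open>The slit square is a John domain\<close>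

text \<open>
  The open square \<open>(-1, 1)\<^sup>2\<close> without the slit \<open>[0, 1) \<times> {0}\<close>. The slit stops in the middle of the square,
  so that its two sides are joined within the domain through the left half.
\<close>

definition slit_square :: "(nat \<Rightarrow> real) set" where
  "slit_square = {z \<in> Rn 2. \<bar>z 0\<bar> < 1 \<and> \<bar>z 1\<bar> < 1 \<and> (z 1 = 0 \<longrightarrow> z 0 < 0)}"

definition point2 :: "real \<Rightarrow> real \<Rightarrow> nat \<Rightarrow> real" where
  "point2 a b = (\<lambda>i\<in>{..<2}. if i = 0 then a else b)"

lemma point2_simps [simp]: "point2 a b \<in> Rn 2" "point2 a b 0 = a" "point2 a b (Suc 0) = b"
  by (auto simp: point2_def Rn_def)

lemma slit_square_subset: "slit_square \<subseteq> Rn 2"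
  by (auto simp: slit_square_def)

lemma openin_slit_square: "openin (Rn.mtopology 2) slit_square"
  unfolding Rn.openin_mtopology
proof (intro conjI allI impI slit_square_subset)
  fix x assume x: "x \<in> slit_square"
  define r where "r = min (min (1 - \<bar>x 0\<bar>) (1 - \<bar>x 1\<bar>)) (if x 1 = 0 then - x 0 else \<bar>x 1\<bar>)"
  have "r > 0" using x by (auto simp: r_def slit_square_def)
  moreover have "y \<in> slit_square" if y: "y \<in> Rn.mball 2 x r" for y
  proof -
    have "\<bar>x 0 - y 0\<bar> < r" "\<bar>x 1 - y 1\<bar> < r" "y \<in> Rn 2"
      using y abs_coord_le_Rdist[of 0 2 x y] abs_coord_le_Rdist[of 1 2 x y] by auto
    moreover have "r \<le> 1 - \<bar>x 0\<bar>" "r \<le> 1 - \<bar>x 1\<bar>" "x 1 = 0 \<Longrightarrow> r \<le> - x 0" "x 1 \<noteq> 0 \<Longrightarrow> r \<le> \<bar>x 1\<bar>"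
      by (simp_all add: r_def min_le_iff_disj)
    ultimately have "\<bar>y 0\<bar> < 1" "\<bar>y 1\<bar> < 1" "y 1 = 0 \<longrightarrow> y 0 < 0"
      by linarith+
    with \<open>y \<in> Rn 2\<close> show ?thesis by (simp add: slit_square_def)
  qed
  ultimately show "\<exists>r>0. Rn.mball 2 x r \<subseteq> slit_square" by auto
qed

lemma slit_in_frontier:
  assumes "0 \<le> a" "a < 1"
  shows "point2 a 0 \<in> Rn.mtopology 2 frontier_of slit_square"
proof -
  have "\<exists>y\<in>slit_square. y \<in> Rn.mball 2 (point2 a 0) r" if "r > 0" for r
    using that assms
    by (intro bexI[of _ "point2 a (min r 1 / 2)"]) (auto simp: slit_square_def Rdist_2)
  moreover have "point2 a 0 \<notin> slit_square" using assms by (auto simp: slit_square_def)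
  ultimately show ?thesis
    using openin_slit_square by (auto simp: frontier_of_def interior_of_openin Rn.metric_closure_of)
qed

text \<open>
  The upper half of the slit square is convex and contains a square of half side length \<open>1 / 2\<close> around
  \<open>(0, 1 / 2)\<close>. Contracting this square towards a point \<open>x\<close> of the half leaves it inside, and the point
  at ratio \<open>r\<close> on the segment from \<open>x\<close> to the centre is the centre of the copy with half side length
  \<open>r / 2\<close>. Thus the distance from the boundary grows linearly on leaving \<open>x\<close>, however close \<open>x\<close> is to
  the slit. The sign \<open>\<sigma>\<close> selects the upper or the lower half.
\<close>

lemma slit_square_first_leg:
  assumes x: "x \<in> Rn 2" "\<bar>x 0\<bar> < 1" "\<bar>x 1\<bar> < 1" and \<sigma>: "\<sigma> = 1 \<or> \<sigma> = -1" "0 \<le> \<sigma> * x 1"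
    and r: "0 \<le> r" "r \<le> 1"
    and w: "w \<in> Rn 2" "Rdist 2 (segment_point 2 x (point2 0 (\<sigma> / 2)) r) w < r / 2"
  shows "w \<in> slit_square"
proof -
  let ?z = "segment_point 2 x (point2 0 (\<sigma> / 2)) r"
  have z: "?z 0 = (1 - r) * x 0" "?z 1 = (1 - r) * x 1 + r * (\<sigma> / 2)"
    by (simp_all add: segment_point_def algebra_simps)
  have "\<bar>?z 0 - w 0\<bar> < r / 2" "\<bar>?z 1 - w 1\<bar> < r / 2"
    using w abs_coord_le_Rdist[of 0 2 ?z w] abs_coord_le_Rdist[of 1 2 ?z w] by auto
  then have w01: "\<bar>(1 - r) * x 0 - w 0\<bar> < r / 2" "\<bar>(1 - r) * x 1 + r * (\<sigma> / 2) - w 1\<bar> < r / 2"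
    unfolding z .
  have x01: "\<bar>(1 - r) * x 0\<bar> \<le> 1 - r" "\<bar>(1 - r) * x 1\<bar> \<le> 1 - r"
    using x r by (simp_all add: abs_mult mult_left_le)
  have sgn: "0 \<le> \<sigma> * ((1 - r) * x 1)"
    using mult_nonneg_nonneg[OF \<sigma>(2), of "1 - r"] r by (simp add: mult_ac)
  have "\<bar>w 0\<bar> < 1" using w01 x01 by linarith
  moreover have "\<bar>w 1\<bar> < 1 \<and> w 1 \<noteq> 0"
    using \<sigma>(1)
  proof
    assume "\<sigma> = 1"
    with w01(2) sgn have "\<bar>(1 - r) * x 1 + r / 2 - w 1\<bar> < r / 2" "0 \<le> (1 - r) * x 1" by simp_all
    with x01(2) show ?thesis by linarith
  next
    assume "\<sigma> = - 1"
    with w01(2) sgn have "\<bar>(1 - r) * x 1 - r / 2 - w 1\<bar> < r / 2" "(1 - r) * x 1 \<le> 0" by simp_all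
    with x01(2) show ?thesis by linarith
  qed
  ultimately show ?thesis
    using w(1) by (simp add: slit_square_def)
qed

text \<open>
  Walking around the tip of the slit stays away from it: a point of the leg that is within vertical
  distance \<open>1 / 4\<close> of the slit line has \<open>r > 1 / 2\<close>, hence lies more than \<open>1 / 4\<close> to the left of the tip.
\<close>

lemma slit_square_second_leg:
  assumes \<sigma>: "\<sigma> = 1 \<or> \<sigma> = -1" and r: "0 \<le> r" "r \<le> 1"
    and w: "w \<in> Rn 2" "Rdist 2 (segment_point 2 (point2 0 (\<sigma> / 2)) (point2 (- 1 / 2) 0) r) w < 1 / 4"
  shows "w \<in> slit_square"
proof -
  let ?z = "segment_point 2 (point2 0 (\<sigma> / 2)) (point2 (- 1 / 2) 0) r"
  have z: "?z 0 = - r / 2" "?z 1 = (1 - r) * \<sigma> / 2"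
    by (simp_all add: segment_point_def algebra_simps)
  have "\<bar>?z 0 - w 0\<bar> < 1 / 4" "\<bar>?z 1 - w 1\<bar> < 1 / 4"
    using w abs_coord_le_Rdist[of 0 2 ?z w] abs_coord_le_Rdist[of 1 2 ?z w] by auto
  then have w01: "\<bar>- r / 2 - w 0\<bar> < 1 / 4" "\<bar>(1 - r) * \<sigma> / 2 - w 1\<bar> < 1 / 4"
    unfolding z .
  then have w0: "- r / 2 - 1 / 4 < w 0" "w 0 < 1 / 4 - r / 2" by linarith+
  have w1: "\<bar>w 1\<bar> < 1 \<and> (w 1 = 0 \<longrightarrow> 1 / 2 < r)"
    using \<sigma>
  proof
    assume "\<sigma> = 1"
    with w01(2) have "\<bar>1 / 2 - r / 2 - w 1\<bar> < 1 / 4" by (simp add: diff_divide_distrib)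
    then have "1 / 2 - r / 2 - 1 / 4 < w 1" "w 1 < 1 / 2 - r / 2 + 1 / 4" by linarith+
    with r show ?thesis by (auto simp: abs_less_iff)
  next
    assume "\<sigma> = - 1"
    with w01(2) have "\<bar>r / 2 - 1 / 2 - w 1\<bar> < 1 / 4" by (simp add: diff_divide_distrib)
    then have "r / 2 - 1 / 2 - 1 / 4 < w 1" "w 1 < r / 2 - 1 / 2 + 1 / 4" by linarith+
    with r show ?thesis by (auto simp: abs_less_iff)
  qed
  then have "w 1 = 0 \<longrightarrow> w 0 < 0" using w0 by auto
  moreover have "\<bar>w 0\<bar> < 1" "\<bar>w 1\<bar> < 1" using w0 w1 r by (auto simp: abs_less_iff)
  ultimately show ?thesis
    using w(1) by (simp add: slit_square_def)
qed

text \<open>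
  The first leg has length \<open>d \<le> 2\<close> and boundary distance at least \<open>t / (2 * d) \<ge> t / 4\<close> at time \<open>t\<close>; on the
  second leg the time is at most \<open>2 + 1\<close> and the boundary distance at least \<open>1 / 4\<close>. The latter gives the
  constant \<open>12\<close>.
\<close>

lemma slit_square_two_leg_path:
  assumes x: "x \<in> slit_square"
  obtains l g where "arclength_curve_in 2 slit_square l g" "g 0 = x" "g l = point2 (- 1 / 2) 0"
    "\<And>t. t \<in> {0..l} \<Longrightarrow> t / 12 \<le> boundary_dist 2 slit_square (g t)"
proof -
  define \<sigma> :: real where "\<sigma> = (if 0 \<le> x 1 then 1 else - 1)"
  define q where "q = point2 0 (\<sigma> / 2)"
  define z where "z = point2 (- 1 / 2) 0"
  define d where "d = Rdist 2 x q"
  define e where "e = Rdist 2 q z"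
  let ?g = "two_leg_path 2 x q z"
  have \<sigma>: "\<sigma> = 1 \<or> \<sigma> = -1" "0 \<le> \<sigma> * x 1" by (auto simp: \<sigma>_def)
  have xR: "x \<in> Rn 2" "\<bar>x 0\<bar> < 1" "\<bar>x 1\<bar> < 1" using x by (auto simp: slit_square_def)
  have Rn: "x \<in> Rn 2" "q \<in> Rn 2" "z \<in> Rn 2" using xR by (auto simp: q_def z_def)
  have de0: "0 \<le> d" "0 \<le> e" by (auto simp: d_def e_def Rdist_nonneg)
  have d: "d \<le> 2"
  proof -
    have "(x 0)\<^sup>2 \<le> 1" "(x 1 - \<sigma> / 2)\<^sup>2 \<le> 1"
      using xR \<sigma> by (auto simp: abs_square_le_1 \<sigma>_def split: if_splits)
    then show ?thesis
      unfolding d_def Rdist_2 by (intro real_le_lsqrt) (auto simp: q_def)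
  qed
  have e: "e \<le> 1"
    unfolding e_def Rdist_2 using \<sigma> by (intro real_le_lsqrt) (auto simp: q_def z_def power2_eq_square)
  have ne: "Rn.mtopology 2 frontier_of slit_square \<noteq> {}"
    using slit_in_frontier[of 0] by auto
  have main: "?g t \<in> slit_square \<and> t / 12 \<le> boundary_dist 2 slit_square (?g t)" if t: "t \<in> {0..d + e}" for t
  proof -
    define r where "r = (if t \<le> d then t / d / 2 else 1 / 4)"
    have rad: "w \<in> slit_square" if "w \<in> Rn 2" "Rdist 2 (?g t) w < r" for w
    proof (cases "t \<le> d")
      case True
      then show ?thesis
        using that t slit_square_first_leg[OF xR \<sigma>, of "t / d" w] de0
        by (auto simp: r_def two_leg_path_def q_def[symmetric] d_def[symmetric] divide_le_eq)
    next
      case False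
      then show ?thesis
        using that t slit_square_second_leg[OF \<sigma>(1), of "(t - d) / e" w, folded q_def z_def] de0
        by (auto simp: r_def two_leg_path_def d_def[symmetric] e_def[symmetric] divide_le_eq)
    qed
    have gR: "?g t \<in> Rn 2" by (auto simp: two_leg_path_def segment_point_in_Rn)
    have "t / 12 \<le> r"
    proof (cases "t \<le> d \<and> d \<noteq> 0")
      case True
      then have "0 < d" "d * t \<le> 2 * t" using t d de0 by (auto intro: mult_right_mono)
      then have "t / 4 \<le> t / d / 2" by (simp add: field_simps)
      then show ?thesis using True t by (auto simp: r_def)
    qed (use t d e in \<open>auto simp: r_def\<close>)
    moreover have "r \<le> boundary_dist 2 slit_square (?g t)"
      using rad by (intro boundary_dist_ge openin_slit_square ne) (meson not_less)
    \<comment> \<open>The radius vanishes only at the start of the path, which is \<open>x\<close>.\<close>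
    moreover have "?g t \<in> slit_square"
    proof (cases "r = 0")
      case True
      then have "?g t = x"
        using t Rn de0 by (auto simp: r_def two_leg_path_def segment_point_ends d_def[symmetric] split: if_splits)
      then show ?thesis using x by simp
    next
      case False
      then have "r > 0" using t de0 by (auto simp: r_def)
      then show ?thesis using rad[OF gR] gR by simp
    qed
    ultimately show ?thesis by auto
  qed
  show ?thesis
  proof (rule that[of "d + e" ?g])
    show "arclength_curve_in 2 slit_square (d + e) ?g"
      using main unfolding d_def e_def by (intro arclength_curve_two_leg_path Rn slit_square_subset) auto
    show "?g 0 = x" using Rn de0 by (simp add: two_leg_path_def segment_point_ends Rdist_nonneg)
    show "?g (d + e) = point2 (- 1 / 2) 0"
      using two_leg_path_end[OF Rn] by (simp add: d_def e_def z_def)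
  qed (use main in blast)
qed

lemma connectedin_slit_square: "connectedin (Rn.mtopology 2) slit_square"
proof -
  let ?z = "point2 (- 1 / 2) 0"
  let ?\<U> = "{S. connectedin (Rn.mtopology 2) S \<and> ?z \<in> S \<and> S \<subseteq> slit_square}"
  have "x \<in> \<Union>?\<U>" if x: "x \<in> slit_square" for x
  proof -
    obtain l g where g: "arclength_curve_in 2 slit_square l g" "g 0 = x" "g l = ?z"
      using slit_square_two_leg_path[OF x] by metis
    then have l: "0 \<le> l" and cont: "continuous_map (top_of_set {0..l}) (Rn.mtopology 2) g"
      and sub: "g ` {0..l} \<subseteq> slit_square"
      by (auto simp: arclength_curve_in_def continuous_map_in_subtopology)
    have "connectedin (Rn.mtopology 2) (g ` {0..l})"
      by (rule connectedin_continuous_map_image[OF cont]) (simp add: connectedin_subtopology)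
    moreover have "?z \<in> g ` {0..l}" using g l by (intro image_eqI[of _ _ l]) auto
    ultimately have "g ` {0..l} \<in> ?\<U>" using sub by blast
    then show ?thesis using g l by (intro UnionI[of "g ` {0..l}"]) auto
  qed
  then have "slit_square = \<Union>?\<U>" by auto
  moreover have "connectedin (Rn.mtopology 2) (\<Union>?\<U>)"
    by (rule connectedin_Union) auto
  ultimately show ?thesis by metis
qed

lemma John_domain_slit_square: "John_domain 2 slit_square"
  unfolding John_domain_def c_John_domain_def
proof (intro exI[of _ 12] conjI openin_slit_square connectedin_slit_square)
  show "Rn.mbounded 2 slit_square"
    unfolding Rn.mbounded
  proof (intro disjI2 conjI ballI exI)
    fix x assume "x \<in> slit_square"
    then have "\<bar>x 0\<bar> < 1" "\<bar>x 1\<bar> < 1" by (auto simp: slit_square_def)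
    then have "(x 0)\<^sup>2 \<le> 1" "(x 1)\<^sup>2 \<le> 1" by (auto simp: abs_square_le_1)
    then show "Rdist 2 (point2 0 0) x \<le> 2"
      unfolding Rdist_2 by (intro real_le_lsqrt) auto
  qed (auto simp: slit_square_def)
  show "\<exists>x0\<in>slit_square. \<forall>x\<in>slit_square. \<exists>l g. arclength_curve_in 2 slit_square l g \<and> g 0 = x \<and>
      g l = x0 \<and> (\<forall>t\<in>{0..l}. t / 12 \<le> boundary_dist 2 slit_square (g t))"
    by (intro bexI[of _ "point2 (- 1 / 2) 0"] ballI)
      (metis slit_square_two_leg_path, simp add: slit_square_def)
qed simp

section \<open>A function that jumps across the slit\<close>

text \<open>
  The ramp \<open>z 0\<close> above the slit and \<open>0\<close> elsewhere: continuous across the gap to the left of the tip, where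
  both formulas give \<open>0\<close>, but with a jump of height \<open>z 0\<close> across the slit.
\<close>

definition jump :: "(nat \<Rightarrow> real) \<Rightarrow> real" where
  "jump z = (if 0 < z 1 then max 0 (z 0) else 0)"

text \<open>
  To the right of the tip, the ball is no larger than the distance from \<open>x\<close> to the slit right below or above
  it, so the ball does not meet the line of the slit and only one formula for \<open>jump\<close> is in force. To the
  left, \<open>jump x = 0\<close>, and \<open>jump y\<close> is at most the positive part of \<open>y 0\<close>, which \<open>y 0 - x 0\<close> dominates.
\<close>

lemma jump_Lipschitz_on_boundary_ball:
  assumes x: "x \<in> slit_square" and y: "Rdist 2 x y < boundary_dist 2 slit_square x"
  shows "\<bar>jump x - jump y\<bar> \<le> \<bar>x 0 - y 0\<bar>"
proof (cases "0 \<le> x 0")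
  case True
  have "x 0 < 1" using x by (auto simp: slit_square_def)
  with boundary_dist_le[OF slit_in_frontier[OF True], of x]
  have "boundary_dist 2 slit_square x \<le> \<bar>x 1\<bar>" by (simp add: Rdist_2)
  then have "\<bar>x 1 - y 1\<bar> < \<bar>x 1\<bar>"
    using y abs_coord_le_Rdist[of 1 2 x y] by simp
  then have "0 < x 1 \<longleftrightarrow> 0 < y 1" by linarith
  then show ?thesis by (auto simp: jump_def)
qed (auto simp: jump_def)

abbreviation plane :: "(nat \<Rightarrow> real) measure" where
  "plane \<equiv> PiM {..<2} (\<lambda>_. lborel)"

lemma nn_integral_plane_prod:
  fixes f g :: "real \<Rightarrow> ennreal"
  assumes [measurable]: "f \<in> borel_measurable borel" "g \<in> borel_measurable borel"
  shows "(\<integral>\<^sup>+ z. f (z 0) * g (z 1) \<partial>plane) = (\<integral>\<^sup>+ t. f t \<partial>lborel) * (\<integral>\<^sup>+ t. g t \<partial>lborel)"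
proof -
  interpret product_sigma_finite "\<lambda>_::nat. lborel :: real measure" ..
  have "(\<integral>\<^sup>+ z. (\<Prod>i\<in>{..<2}. (if i = 0 then f else g) (z i)) \<partial>PiM {..<2::nat} (\<lambda>_. lborel))
    = (\<Prod>i\<in>{..<2::nat}. \<integral>\<^sup>+ t. (if i = 0 then f else g) t \<partial>lborel)"
    by (rule product_nn_integral_prod) auto
  then show ?thesis by (simp add: numeral_2_eq_2 mult.commute)
qed

lemma slit_square_measurable: "slit_square \<in> sets plane"
proof -
  have "slit_square = {z \<in> space plane. \<bar>z 0\<bar> < 1 \<and> \<bar>z 1\<bar> < 1 \<and> (z 1 = 0 \<longrightarrow> z 0 < 0)}"
    by (simp add: slit_square_def Rn_def space_PiM)
  also have "\<dots> \<in> sets plane" by measurable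
  finally show ?thesis .
qed

lemma emeasure_slit_square_finite: "emeasure plane slit_square < \<infinity>"
proof -
  let ?I = "indicator {-1..1::real} :: real \<Rightarrow> ennreal"
  have "emeasure plane slit_square
    = (\<integral>\<^sup>+ z. indicator slit_square z \<partial>plane)"
    using slit_square_measurable by simp
  also have "\<dots> \<le> (\<integral>\<^sup>+ z. ?I (z 0) * ?I (z 1) \<partial>plane)"
    by (intro nn_integral_mono) (auto simp: slit_square_def split: split_indicator)
  also have "\<dots> = 2 * 2"
    by (subst nn_integral_plane_prod) auto
  also have "\<dots> < \<infinity>" by (simp add: ennreal_mult_less_top)
  finally show ?thesis .
qed

lemma jump_integrable: "set_integrable (Rn_lebesgue 2) slit_square jump"
proof -
  note [measurable] = slit_square_measurable
  have [measurable]: "jump \<in> borel_measurable plane"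
    unfolding jump_def[abs_def] by measurable
  have "AE z in plane. z \<in> slit_square \<longrightarrow> norm (jump z) \<le> 1"
    by (auto simp: slit_square_def jump_def)
  then have "integrable plane (\<lambda>z. indicator slit_square z *\<^sub>R jump z)"
    using emeasure_slit_square_finite
    by (intro integrableI_bounded_set_indicator[where B = 1]) simp_all
  moreover have "(\<lambda>z. indicator slit_square z *\<^sub>R jump z) \<in> borel_measurable plane"
    by measurable
  ultimately show ?thesis
    unfolding set_integrable_def Rn_lebesgue_def by (simp only: integrable_completion)
qed

section \<open>The energy over boundary balls is finite\<close>

lemma boundary_dist_slit_square_less_2:
  assumes "x \<in> slit_square"
  shows "boundary_dist 2 slit_square x < 2"
proof -
  from assms have "\<bar>x 0\<bar> < 1" "\<bar>x 1\<bar> < 1" by (auto simp: slit_square_def)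
  then have "(x 0)\<^sup>2 < 1" "(x 1)\<^sup>2 < 1" by (auto simp: abs_square_less_1)
  then have "Rdist 2 x (point2 0 0) < 2"
    unfolding Rdist_2 by (intro real_less_lsqrt) auto
  with boundary_dist_le[OF slit_in_frontier[of 0], of x] show ?thesis by simp
qed

text \<open>
  The value at \<open>0\<close> is infinite (whereas \<open>0 powr s = 0\<close>), so that products of two such functions also bound
  the kernel at points that differ in one coordinate only.
\<close>

definition truncated_powr :: "real \<Rightarrow> real \<Rightarrow> ennreal" where
  "truncated_powr s t = (if t = 0 then top else ennreal (\<bar>t\<bar> powr s)) * indicator {-2..2} t"

lemma truncated_powr_measurable [measurable]: "truncated_powr s \<in> borel_measurable borel"
  unfolding truncated_powr_def[abs_def] by measurable

lemma nn_integral_truncated_powr: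
  assumes s: "-1 < s"
  shows "(\<integral>\<^sup>+ t. truncated_powr s t \<partial>lborel) < \<infinity>"
proof -
  have half: "(\<integral>\<^sup>+ t. ennreal (indicator {0..2} t * t powr s) \<partial>lborel) < \<infinity>"
    by (subst nn_integral_has_integral_lebesgue[OF _ has_integral_powr_from_0[OF s]]) auto
  have "(\<integral>\<^sup>+ t. ennreal (indicator {0..2} (-t) * (-t) powr s) \<partial>lborel)
     = (\<integral>\<^sup>+ t. ennreal (indicator {0..2} t * t powr s) \<partial>lborel)"
    using nn_integral_real_affine[of "\<lambda>t. ennreal (indicator {0..2} t * t powr s)" "-1" 0] by simp
  then have half': "(\<integral>\<^sup>+ t. ennreal (indicator {0..2} (-t) * (-t) powr s) \<partial>lborel) < \<infinity>"
    using half by simp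
  have "(\<integral>\<^sup>+ t. truncated_powr s t \<partial>lborel) = (\<integral>\<^sup>+ t. ennreal (indicator {0..2} t * t powr s)
      + ennreal (indicator {0..2} (-t) * (-t) powr s) \<partial>lborel)"
    using AE_lborel_singleton[of 0]
    by (intro nn_integral_cong_AE, eventually_elim) (auto simp: truncated_powr_def split: split_indicator)
  also have "\<dots> = (\<integral>\<^sup>+ t. ennreal (indicator {0..2} t * t powr s) \<partial>lborel)
      + (\<integral>\<^sup>+ t. ennreal (indicator {0..2} (-t) * (-t) powr s) \<partial>lborel)"
    by (rule nn_integral_add) measurable
  also have "\<dots> < \<infinity>" using half half' by simp
  finally show ?thesis .
qed

lemma nn_integral_truncated_powr_shift:
  "(\<integral>\<^sup>+ t. truncated_powr s (t - c) \<partial>lborel) = (\<integral>\<^sup>+ t. truncated_powr s t \<partial>lborel)"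
  using nn_integral_real_affine[of "truncated_powr s" 1 "-c"] by (simp add: algebra_simps)

text \<open>
  With \<open>D = Rdist 2 x y\<close>, the Lipschitz bound gives the kernel the size \<open>D powr (\<eta> - 2)\<close>. As \<open>D\<^sup>2\<close> is at least
  the product of the coordinate differences, this is at most a product of powers of these differences with
  exponents \<open>\<eta> / 2 - 1 > -1\<close>, which can be integrated one coordinate at a time. Since \<open>D \<le> 2\<close>, an \<open>\<eta>\<close> above
  \<open>1\<close> may be lowered to \<open>1\<close> at the cost of a constant; this keeps the exponent \<open>s\<close> negative.
\<close>

lemma kernel_le_truncated_powr:
  assumes p: "0 < p" and \<eta>: "\<eta> = p - \<delta> * p" "0 < \<eta>" and s: "s = min 1 \<eta> / 2 - 1"
    and lip: "\<bar>u x - u y\<bar> \<le> \<bar>x 0 - y 0\<bar>" and D: "Rdist 2 x y \<le> 2"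
  shows "frac_kernel 2 \<delta> p u x y
    \<le> ennreal (2 powr (\<eta> - min 1 \<eta>)) * (truncated_powr s (y 0 - x 0) * truncated_powr s (y 1 - x 1))"
proof -
  define a b D where "a = \<bar>x 0 - y 0\<bar>" and "b = \<bar>x 1 - y 1\<bar>" and "D = Rdist 2 x y"
  have ab: "0 \<le> a" "0 \<le> b" "a \<le> D" "b \<le> D" and D2: "D \<le> 2"
    using abs_coord_le_Rdist[of 0 2 x y] abs_coord_le_Rdist[of 1 2 x y] D by (auto simp: a_def b_def D_def)
  consider "a = 0" | "a \<noteq> 0" "b = 0" | "a \<noteq> 0" "b \<noteq> 0" by blast
  then show ?thesis
  proof cases
    case 1
    then show ?thesis using lip by (simp add: frac_kernel_def a_def)
  next
    case 2
    then have "truncated_powr s (y 0 - x 0) \<noteq> 0" "truncated_powr s (y 1 - x 1) = top"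
      using ab D2 by (auto simp: truncated_powr_def a_def b_def indicator_def abs_le_iff)
    then show ?thesis by (simp add: ennreal_mult_top)
  next
    case 3
    then have pos: "0 < a" "0 < b" "0 < D" using ab by auto
    have s0: "s \<le> 0" using s by auto
    have "\<bar>u x - u y\<bar> powr p / D powr (real 2 + \<delta> * p) \<le> D powr p / D powr (real 2 + \<delta> * p)"
      using lip ab p pos by (intro divide_right_mono powr_mono2) (auto simp: a_def)
    also have "\<dots> = D powr (\<eta> - min 1 \<eta>) * D powr (2 * s)"
      by (simp add: s \<eta>(1) algebra_simps flip: powr_diff powr_add)
    also have "D powr (2 * s) = (D\<^sup>2) powr s"
      using pos by (simp add: powr_powr flip: powr_numeral)
    also have "D powr (\<eta> - min 1 \<eta>) * (D\<^sup>2) powr s \<le> 2 powr (\<eta> - min 1 \<eta>) * (a * b) powr s"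
    proof (rule mult_mono)
      show "D powr (\<eta> - min 1 \<eta>) \<le> 2 powr (\<eta> - min 1 \<eta>)" using pos D2 by (intro powr_mono2) auto
      have "a * b \<le> D\<^sup>2" using ab unfolding power2_eq_square by (intro mult_mono) auto
      then show "(D\<^sup>2) powr s \<le> (a * b) powr s" using pos s0 by (intro powr_mono2') auto
    qed auto
    also have "\<dots> = 2 powr (\<eta> - min 1 \<eta>) * (a powr s * b powr s)"
      using ab by (simp add: powr_mult)
    finally have "frac_kernel 2 \<delta> p u x y \<le> ennreal (2 powr (\<eta> - min 1 \<eta>) * (a powr s * b powr s))"
      by (simp add: frac_kernel_def D_def)
    also have "\<dots> = ennreal (2 powr (\<eta> - min 1 \<eta>)) * (truncated_powr s (y 0 - x 0) * truncated_powr s (y 1 - x 1))"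
      using 3 ab D2
      by (auto simp: truncated_powr_def a_def b_def indicator_def ennreal_mult abs_le_iff abs_minus_commute)
    finally show ?thesis .
  qed
qed

text \<open>
  The inner integral is bounded uniformly in \<open>x\<close>, because \<open>\<eta> = p * (1 - \<delta>)\<close> is positive.
\<close>

lemma boundary_ball_energy_finite:
  assumes p: "1 \<le> p" "\<delta> < 1"
  shows "(\<integral>\<^sup>+ x\<in>slit_square. (\<integral>\<^sup>+ y\<in>Rn.mball 2 x (boundary_dist 2 slit_square x).
      frac_kernel 2 \<delta> p jump x y \<partial>Rn_lebesgue 2) \<partial>Rn_lebesgue 2) < \<infinity>"
proof -
  define \<eta> s where "\<eta> = p - \<delta> * p" and "s = min 1 \<eta> / 2 - 1"
  have \<eta>: "0 < \<eta>" using p by (simp add: \<eta>_def)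
  define K where "K = ennreal (2 powr (\<eta> - min 1 \<eta>)) *
    ((\<integral>\<^sup>+ t. truncated_powr s t \<partial>lborel) * (\<integral>\<^sup>+ t. truncated_powr s t \<partial>lborel))"
  have "(\<integral>\<^sup>+ t. truncated_powr s t \<partial>lborel) < \<infinity>"
    using \<eta> by (intro nn_integral_truncated_powr) (simp add: s_def)
  then have K: "K < \<infinity>" by (simp add: K_def ennreal_mult_less_top)
  have inner: "(\<integral>\<^sup>+ y\<in>Rn.mball 2 x (boundary_dist 2 slit_square x). frac_kernel 2 \<delta> p jump x y \<partial>Rn_lebesgue 2) \<le> K"
    if x: "x \<in> slit_square" for x
  proof -
    have "frac_kernel 2 \<delta> p jump x y * indicator (Rn.mball 2 x (boundary_dist 2 slit_square x)) y
      \<le> ennreal (2 powr (\<eta> - min 1 \<eta>)) * (truncated_powr s (y 0 - x 0) * truncated_powr s (y 1 - x 1))" for y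
    proof (cases "y \<in> Rn.mball 2 x (boundary_dist 2 slit_square x)")
      case True
      then have y: "Rdist 2 x y < boundary_dist 2 slit_square x" by simp
      have "frac_kernel 2 \<delta> p jump x y
        \<le> ennreal (2 powr (\<eta> - min 1 \<eta>)) * (truncated_powr s (y 0 - x 0) * truncated_powr s (y 1 - x 1))"
        using p \<eta> y boundary_dist_slit_square_less_2[OF x] jump_Lipschitz_on_boundary_ball[OF x y]
        by (intro kernel_le_truncated_powr) (auto simp: \<eta>_def s_def)
      then show ?thesis using True by simp
    qed simp
    then have "(\<integral>\<^sup>+ y\<in>Rn.mball 2 x (boundary_dist 2 slit_square x). frac_kernel 2 \<delta> p jump x y \<partial>Rn_lebesgue 2)
      \<le> (\<integral>\<^sup>+ y. ennreal (2 powr (\<eta> - min 1 \<eta>)) * (truncated_powr s (y 0 - x 0) * truncated_powr s (y 1 - x 1)) \<partial>plane)"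
      unfolding Rn_lebesgue_def nn_integral_completion by (intro nn_integral_mono) auto
    also have "\<dots> = K"
      by (simp add: nn_integral_cmult K_def nn_integral_truncated_powr_shift
          nn_integral_plane_prod[of "\<lambda>t. truncated_powr s (t - x 0)" "\<lambda>t. truncated_powr s (t - x 1)", simplified])
    finally show ?thesis .
  qed
  have "(\<integral>\<^sup>+ x\<in>slit_square. (\<integral>\<^sup>+ y\<in>Rn.mball 2 x (boundary_dist 2 slit_square x).
      frac_kernel 2 \<delta> p jump x y \<partial>Rn_lebesgue 2) \<partial>Rn_lebesgue 2)
    \<le> (\<integral>\<^sup>+ x. K * indicator slit_square x \<partial>Rn_lebesgue 2)"
    using inner by (intro nn_integral_mono) (auto split: split_indicator)
  also have "\<dots> = K * emeasure plane slit_square"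
    unfolding Rn_lebesgue_def nn_integral_completion
    using slit_square_measurable by (rule nn_integral_cmult_indicator)
  also have "\<dots> < \<infinity>" using K emeasure_slit_square_finite by (simp add: ennreal_mult_less_top)
  finally show ?thesis .
qed

section \<open>The energy over the whole domain is infinite\<close>

lemma nn_integral_inverse_near_0:
  assumes b: "0 < b"
  shows "(\<integral>\<^sup>+ t. ennreal (1 / t) * indicator {0<..<b} t \<partial>lborel) = \<infinity>"
proof -
  have ge: "ennreal N \<le> (\<integral>\<^sup>+ t. ennreal (1 / t) * indicator {0<..<b} t \<partial>lborel)" if "0 \<le> N" for N
  proof -
    \<comment> \<open>The left end point for which the integral over \<open>[c, b / 2]\<close> is exactly \<open>N\<close>.\<close>
    define c where "c = (b / 2) * exp (- N)"
    have c: "0 < c" "c \<le> b / 2" using b that by (auto simp: c_def mult_le_cancel_left1)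
    have "ennreal N = ennreal (ln (b / 2) - ln c)"
      using b by (simp add: c_def ln_mult ln_div)
    also have "\<dots> = (\<integral>\<^sup>+ t. ennreal (1 / t) * indicator {c..b / 2} t \<partial>lborel)"
      using c by (intro nn_integral_FTC_Icc[symmetric]) (auto intro!: derivative_eq_intros)
    also have "\<dots> \<le> (\<integral>\<^sup>+ t. ennreal (1 / t) * indicator {0<..<b} t \<partial>lborel)"
      using c b by (intro nn_integral_mono) (auto split: split_indicator)
    finally show ?thesis .
  qed
  show ?thesis
  proof (cases "\<integral>\<^sup>+ t. ennreal (1 / t) * indicator {0<..<b} t \<partial>lborel")
    case (real r)
    with ge[of "r + 1"] show ?thesis by simp
  qed simp
qed

text \<open>
  At height \<open>h\<close> above the slit, a box of size comparable to \<open>h\<close> just below it is at distance at most \<open>3 * h\<close>.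
  As \<open>3 * h \<le> 1\<close>, the exponent \<open>2 + \<delta> * p \<ge> 3\<close> may be replaced by \<open>3\<close>; this is where \<open>1 \<le> p * \<delta>\<close> enters.
\<close>

lemma jump_kernel_ge:
  assumes x: "1 / 2 < x 0" "x 1 = h" and h: "0 < h" "h \<le> 1 / 3"
    and y: "\<bar>x 0 - y 0\<bar> \<le> h" "- h \<le> y 1" "y 1 \<le> 0" and p: "0 \<le> p" "1 \<le> p * \<delta>"
  shows "ennreal ((1 / 2) powr p / (3 * h) ^ 3) \<le> frac_kernel 2 \<delta> p jump x y"
proof -
  define D where "D = Rdist 2 x y"
  have "(x 0 - y 0)\<^sup>2 \<le> h\<^sup>2" using y(1) h by (simp add: abs_le_square_iff[symmetric])
  moreover have "(x 1 - y 1)\<^sup>2 \<le> (2 * h)\<^sup>2" using x y h by (intro power_mono) auto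
  moreover have "(2 * h)\<^sup>2 = 4 * h\<^sup>2" "(3 * h)\<^sup>2 = 9 * h\<^sup>2" by (simp_all add: power_mult_distrib)
  ultimately have "(x 0 - y 0)\<^sup>2 + (x 1 - y 1)\<^sup>2 \<le> (3 * h)\<^sup>2"
    using zero_le_power2[of h] by linarith
  then have D: "D \<le> 3 * h" unfolding D_def Rdist_2 using h by (intro real_le_lsqrt) auto
  have "0 < D" using abs_coord_le_Rdist[of 1 2 x y] x y h by (simp add: D_def)
  have "D powr (2 + \<delta> * p) \<le> (3 * h) powr (2 + \<delta> * p)"
    using D \<open>0 < D\<close> p by (intro powr_mono2) (auto simp: mult.commute)
  also have "\<dots> \<le> (3 * h) powr 3"
    using h p by (intro powr_mono') (auto simp: mult.commute)
  finally have "D powr (2 + \<delta> * p) \<le> (3 * h) ^ 3" using h by (simp add: powr_numeral)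
  moreover have "(1 / 2) powr p \<le> \<bar>jump x - jump y\<bar> powr p"
    using x y h p by (intro powr_mono2) (auto simp: jump_def)
  ultimately show ?thesis
    unfolding frac_kernel_def using \<open>0 < D\<close>
    by (intro ennreal_leI frac_le) (auto simp: D_def)
qed

text \<open>
  At height \<open>h\<close> above the slit, integrating the lower bound of order \<open>h\<close> to the power \<open>-3\<close> over a square of
  side \<open>h\<close> below the slit gives a multiple of \<open>1 / h\<close>, which is not integrable at \<open>0\<close>.
\<close>

lemma jump_energy_infinite:
  assumes p: "0 \<le> p" "1 \<le> p * \<delta>"
  shows "(\<integral>\<^sup>+ x\<in>slit_square. (\<integral>\<^sup>+ y\<in>slit_square. frac_kernel 2 \<delta> p jump x y \<partial>Rn_lebesgue 2) \<partial>Rn_lebesgue 2) = \<infinity>"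
proof -
  define c :: real where "c = (1 / 2) powr p / 27"
  have c: "0 < c" by (simp add: c_def)
  let ?I = "\<lambda>x. \<integral>\<^sup>+ y\<in>slit_square. frac_kernel 2 \<delta> p jump x y \<partial>plane"
  let ?f = "indicator {1 / 2<..<1} :: real \<Rightarrow> ennreal"
  let ?g = "\<lambda>t::real. ennreal (1 / t) * indicator {0<..<1 / 3} t"
  have inner: "ennreal (c * (1 / x 1)) \<le> ?I x"
    if x: "1 / 2 < x 0" "x 0 < 1" "0 < x 1" "x 1 < 1 / 3" for x
  proof -
    define h where "h = x 1"
    have h: "0 < h" "h < 1 / 3" using x by (auto simp: h_def)
    let ?A = "indicator {x 0 - h..x 0} :: real \<Rightarrow> ennreal"
    let ?B = "indicator {- h..<0} :: real \<Rightarrow> ennreal"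
    have "ennreal (c * (1 / h)) = ennreal (c / h ^ 3) * (ennreal h * ennreal h)"
      using h c by (simp add: power3_eq_cube flip: ennreal_mult)
    also have "\<dots> = ennreal (c / h ^ 3) * (\<integral>\<^sup>+ y. ?A (y 0) * ?B (y 1) \<partial>plane)"
      using h by (subst nn_integral_plane_prod) auto
    also have "\<dots> = (\<integral>\<^sup>+ y. ennreal (c / h ^ 3) * (?A (y 0) * ?B (y 1)) \<partial>plane)"
      by (rule nn_integral_cmult[symmetric]) measurable
    also have "\<dots> \<le> ?I x"
    proof (rule nn_integral_mono)
      fix y assume y: "y \<in> space plane"
      show "ennreal (c / h ^ 3) * (?A (y 0) * ?B (y 1)) \<le> frac_kernel 2 \<delta> p jump x y * indicator slit_square y"
      proof (cases "y 0 \<in> {x 0 - h..x 0} \<and> y 1 \<in> {- h..<0}")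
        case True
        then have "y \<in> slit_square"
          using y x h by (auto simp: slit_square_def Rn_def space_PiM)
        moreover have "ennreal ((1 / 2) powr p / (3 * h) ^ 3) \<le> frac_kernel 2 \<delta> p jump x y"
          using True x h p by (intro jump_kernel_ge) (auto simp: h_def)
        ultimately show ?thesis using True by (simp add: c_def power_mult_distrib)
      qed (auto split: split_indicator)
    qed
    finally show ?thesis by (simp add: h_def)
  qed
  have "\<infinity> = ennreal c * ((\<integral>\<^sup>+ t. ?f t \<partial>lborel) * (\<integral>\<^sup>+ t. ?g t \<partial>lborel))"
    using c by (simp add: nn_integral_inverse_near_0 ennreal_mult_top)
  also have "\<dots> = ennreal c * (\<integral>\<^sup>+ x. ?f (x 0) * ?g (x 1) \<partial>plane)"
    by (subst nn_integral_plane_prod) auto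
  also have "\<dots> = (\<integral>\<^sup>+ x. ennreal c * (?f (x 0) * ?g (x 1)) \<partial>plane)"
    by (rule nn_integral_cmult[symmetric]) measurable
  also have "\<dots> \<le> (\<integral>\<^sup>+ x\<in>slit_square. ?I x \<partial>plane)"
  proof (rule nn_integral_mono)
    fix x assume x: "x \<in> space plane"
    show "ennreal c * (?f (x 0) * ?g (x 1)) \<le> ?I x * indicator slit_square x"
    proof (cases "x 0 \<in> {1 / 2<..<1} \<and> x 1 \<in> {0<..<1 / 3}")
      case True
      then have "x \<in> slit_square" using x by (auto simp: slit_square_def Rn_def space_PiM)
      then show ?thesis using True inner[of x] c by (simp add: flip: ennreal_mult)
    qed (auto split: split_indicator)
  qed
  finally show ?thesis
    by (simp add: Rn_lebesgue_def nn_integral_completion top.extremum_unique)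
qed

theorem proposition3p4:
  fixes p \<delta> :: real
  assumes "1 \<le> p" and "0 < \<delta>" and "\<delta> < 1" and "1 \<le> p * \<delta>"
  shows "\<exists>n::nat. 2 \<le> n \<and> (\<exists>G. John_domain n G \<and>
    \<not> (\<exists>C::real. 0 < C \<and>
        (\<forall>u :: (nat \<Rightarrow> real) \<Rightarrow> real. set_integrable (Rn_lebesgue n) G u \<longrightarrow>
          (\<integral>\<^sup>+ x\<in>G. (\<integral>\<^sup>+ y\<in>G. frac_kernel n \<delta> p u x y \<partial>Rn_lebesgue n) \<partial>Rn_lebesgue n)
          \<le> ennreal C *
            (\<integral>\<^sup>+ x\<in>G. (\<integral>\<^sup>+ y\<in>Rn.mball n x (boundary_dist n G x).
               frac_kernel n \<delta> p u x y \<partial>Rn_lebesgue n) \<partial>Rn_lebesgue n))))"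
proof (intro exI[of _ 2] conjI exI[of _ slit_square] John_domain_slit_square notI)
  let ?E = "\<integral>\<^sup>+ x\<in>slit_square. (\<integral>\<^sup>+ y\<in>Rn.mball 2 x (boundary_dist 2 slit_square x).
    frac_kernel 2 \<delta> p jump x y \<partial>Rn_lebesgue 2) \<partial>Rn_lebesgue 2"
  assume "\<exists>C::real. 0 < C \<and> (\<forall>u. set_integrable (Rn_lebesgue 2) slit_square u \<longrightarrow>
      (\<integral>\<^sup>+ x\<in>slit_square. (\<integral>\<^sup>+ y\<in>slit_square. frac_kernel 2 \<delta> p u x y \<partial>Rn_lebesgue 2) \<partial>Rn_lebesgue 2)
      \<le> ennreal C * (\<integral>\<^sup>+ x\<in>slit_square. (\<integral>\<^sup>+ y\<in>Rn.mball 2 x (boundary_dist 2 slit_square x).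
          frac_kernel 2 \<delta> p u x y \<partial>Rn_lebesgue 2) \<partial>Rn_lebesgue 2))"
  then obtain C :: real where "\<infinity> \<le> ennreal C * ?E"
    using jump_integrable jump_energy_infinite[of p \<delta>] assms by fastforce
  moreover have "ennreal C * ?E < \<infinity>"
    using boundary_ball_energy_finite[of p \<delta>] assms by (simp add: ennreal_mult_less_top)
  ultimately show False by simp
qed simp

end
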